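(* Let $(U,\Lambda,D,V)$ be an analytic problem with an MRD discretization of $V$, let $U_M\subseteq U$ be a finite-dimensional subspace, and let $(R_N,V_N)$ be an admissible restriction with $$\|u_M\|_D\le 2\,\|R_ND(u_M)\|_{V_N}\quad\text{for all }u_M\in U_M .$$ Let $v^*\in V$ be given (noisy) data, let $C_A\ge 1$, let $u_M^*\in U_M$ be any comparison trial object, and let $\tilde u_M\in U_M$ satisfy $$\|R_Nv^*-R_ND\tilde u_M\|_{V_N}\le C_A\,\|R_Nv^*-R_NDu_M^*\|_{V_N}.$$ Then $$\|\tilde u_M-u^*\|_D\le (2C_A+3)\,\|u_M^*-u^*\|_D+(2C_A+2)\,\|v^*-Du^*\|_V$$ for any $u^*\in U$.
   Context: Analytic problem: a real normed linear space $U$ (objects), a set $\Lambda$ of linear functionals on $U$, the data map $D:U\to\mathbb{R}^\Lambda$, $D(u)=\{\lambda(u)\}_{\lambda\in\Lambda}$, and a normed data space $V\subseteq\mathbb{R}^\Lambda$ containing $D(U)$ whose norm satisfies $\|Du\|_V=\sup_{\lambda\in\Lambda}|\lambda(u)|<\infty$ for all $u\in U$. Put $\|u\|_D:=\|Du\|_V$ (a seminorm on $U$). MRD (monotone refinable dense) discretization of a normed data space $V$: a (nonempty) set of pairs $(R_N,V_N)$, called admissible restrictions, together with a relation $\preceq$ (refinement) on them, such that (1) each $V_N$ is a finite-dimensional real normed space with norm $\|\cdot\|_{V_N}$; (2) each $R_N:V\to V_N$ is linear; (3) (monotonicity) $(R_M,V_M)\preceq(R_N,V_N)$ implies $\|R_Mv\|_{V_M}\le\|R_Nv\|_{V_N}$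 for all $v\in V$; (4) (refinement) for any two admissible restrictions $(R_M,V_M)$, $(R_N,V_N)$ there is an admissible restriction $(R_P,V_P)$ with $(R_M,V_M)\preceq(R_P,V_P)$ and $(R_N,V_N)\preceq(R_P,V_P)$; (5) (density) $\|v\|_V=\sup\|R_Nv\|_{V_N}$ for all $v\in V$, the supremum being over all admissible restrictions. *)

theory Defs
  imports "HOL-Analysis.Analysis" "HOL-Library.Function_Algebras"
begin

text \<open>Real-valued data and their spaces are treated with the pointwise vector operations;
  \<^theory>\<open>HOL-Library.Function_Algebras\<close> provides the additive part.\<close>

instantiation "fun" :: (type, real_vector) real_vector
begin

definition scaleR_fun :: "real \<Rightarrow> ('a \<Rightarrow> 'b) \<Rightarrow> 'a \<Rightarrow> 'b" where
  "scaleR_fun c f = (\<lambda>x. c *\<^sub>R f x)"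

instance
  by standard (auto simp: scaleR_fun_def fun_eq_iff scaleR_add_right scaleR_add_left)

end

text \<open>Neither the data space nor the target spaces of the restrictions carry a norm coming from
  their type, and different target spaces may have different dimensions. A normed space is therefore a linear subspace
  of an ambient real vector space together with a function that is a norm on that subspace;
  values outside the subspace are irrelevant.\<close>

locale normed_subspace =
  fixes W :: "'w::real_vector set" and n :: "'w \<Rightarrow> real"
  assumes subspace: "subspace W"
    and nonneg: "x \<in> W \<Longrightarrow> 0 \<le> n x"
    and eq_0_iff: "x \<in> W \<Longrightarrow> n x = 0 \<longleftrightarrow> x = 0"
    and triangle: "x \<in> W \<Longrightarrow> y \<in> W \<Longrightarrow> n (x + y) \<le> n x + n y"
    and homogeneous: "x \<in> W \<Longrightarrow> n (c *\<^sub>R x) = \<bar>c\<bar> * n x"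

definition finite_dim :: "'w::real_vector set \<Rightarrow> bool" where
  "finite_dim W \<longleftrightarrow> (\<exists>B. finite B \<and> W = span B)"

definition linear_between ::
    "'v::real_vector set \<Rightarrow> 'w::real_vector set \<Rightarrow> ('v \<Rightarrow> 'w) \<Rightarrow> bool" where
  "linear_between V W R \<longleftrightarrow>
     (\<forall>x\<in>V. R x \<in> W) \<and>
     (\<forall>x\<in>V. \<forall>y\<in>V. R (x + y) = R x + R y) \<and>
     (\<forall>c. \<forall>x\<in>V. R (c *\<^sub>R x) = c *\<^sub>R R x)"


type_synonym 'u data = "('u \<Rightarrow> real) \<Rightarrow> real"

text \<open>The space of all real families indexed by \<open>\<Lambda>\<close>: a family is represented by its
  extension by zero outside \<open>\<Lambda>\<close>.\<close>

definition data_families :: "('u \<Rightarrow> real) set \<Rightarrow> 'u data set" where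
  "data_families \<Lambda> = {f. \<forall>l. l \<notin> \<Lambda> \<longrightarrow> f l = 0}"

definition data_map :: "('u \<Rightarrow> real) set \<Rightarrow> 'u \<Rightarrow> 'u data" where
  "data_map \<Lambda> u = (\<lambda>l. if l \<in> \<Lambda> then l u else 0)"

text \<open>The supremum is taken in \<open>[0, \<infinity>]\<close>, so the last assumption also expresses that it is finite,
  and it is \<open>0\<close> for empty \<open>\<Lambda>\<close>.\<close>

locale analytic_problem =
  fixes \<Lambda> :: "('u::real_normed_vector \<Rightarrow> real) set"
    and V :: "'u data set"
    and normV :: "'u data \<Rightarrow> real"
  assumes functionals_linear: "l \<in> \<Lambda> \<Longrightarrow> linear l"
    and normed_data_space: "normed_subspace V normV"
    and data_space_subset: "V \<subseteq> data_families \<Lambda>"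
    and data_map_in: "data_map \<Lambda> u \<in> V"
    and norm_data_map: "ennreal (normV (data_map \<Lambda> u)) = (SUP l\<in>\<Lambda>. ennreal \<bar>l u\<bar>)"

definition data_seminorm ::
    "('u \<Rightarrow> real) set \<Rightarrow> ('u data \<Rightarrow> real) \<Rightarrow> 'u \<Rightarrow> real" where
  "data_seminorm \<Lambda> normV u = normV (data_map \<Lambda> u)"

text \<open>A restriction \<open>(R, W, n)\<close> consists of a map \<open>R\<close> on the data space and a normed space
  \<open>(W, n)\<close>.\<close>

type_synonym ('v, 'w) restriction = "('v \<Rightarrow> 'w) \<times> 'w set \<times> ('w \<Rightarrow> real)"

locale MRD_discretization =
  fixes V :: "'v::real_vector set"
    and normV :: "'v \<Rightarrow> real"
    and \<A> :: "('v, 'w::real_vector) restriction set"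
    and refines :: "('v, 'w) restriction \<Rightarrow> ('v, 'w) restriction \<Rightarrow> bool" (infix "\<preceq>" 50)
  assumes nonempty: "\<A> \<noteq> {}"
    and restriction_normed: "(R, W, n) \<in> \<A> \<Longrightarrow> normed_subspace W n"
    and restriction_finite_dim: "(R, W, n) \<in> \<A> \<Longrightarrow> finite_dim W"
    and restriction_linear: "(R, W, n) \<in> \<A> \<Longrightarrow> linear_between V W R"
    and monotone: "(R, W, n) \<in> \<A> \<Longrightarrow> (R', W', n') \<in> \<A> \<Longrightarrow> (R, W, n) \<preceq> (R', W', n') \<Longrightarrow>
      v \<in> V \<Longrightarrow> n (R v) \<le> n' (R' v)"
    and refinement: "r \<in> \<A> \<Longrightarrow> s \<in> \<A> \<Longrightarrow> \<exists>p\<in>\<A>. r \<preceq> p \<and> s \<preceq> p"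
    and density: "v \<in> V \<Longrightarrow> ennreal (normV v) = (SUP (R, W, n)\<in>\<A>. ennreal (n (R v)))"

end

theory Submission
  imports Defs
begin

text \<open>For a restriction \<open>(R, W, normW)\<close> with stability constant 2 on the trial space, the error
  bound is a quasi-optimality estimate in the style of Cea's lemma. Write \<open>D\<close> for the data map. The
  difference of the computed object \<open>uM'\<close> and the comparison object \<open>uM\<close> lies in the trial
  space, so stability bounds its seminorm by twice the discrete norm of its restricted data. There
  it splits into the two residuals of \<open>v\<close>, and near-minimality of \<open>uM'\<close> bounds the sum of
  these by \<open>C + 1\<close> times the residual of \<open>uM\<close>. Density bounds every restriction by the norm
  of \<open>V\<close> (\<open>restriction_norm_le\<close>), whence
  \<open>\<parallel>uM' - uM\<parallel>\<^sub>D \<le> (2 C + 2) \<parallel>v - D uM\<parallel>\<close>.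
  Inserting \<open>D u\<close> in the residual, and \<open>uM\<close> in the error \<open>uM' - u\<close>, gives the claim; the latter
  adds one more copy of \<open>\<parallel>uM - u\<parallel>\<^sub>D\<close>.\<close>

lemma (in normed_subspace) norm_diff_commute:
  assumes "x \<in> W" "y \<in> W"
  shows "n (x - y) = n (y - x)"
  using homogeneous[of "y - x" "-1"] subspace_diff[OF subspace] assms by simp

lemma (in normed_subspace) norm_diff_triangle:
  assumes "x \<in> W" "y \<in> W" "z \<in> W"
  shows "n (x - z) \<le> n (x - y) + n (y - z)"
  using triangle[of "x - y" "y - z"] subspace_diff[OF subspace] assms by simp

lemma linear_between_diff:
  assumes "linear_between V W R" "subspace V" "x \<in> V" "y \<in> V"
  shows "R (x - y) = R x - R y"
proof -
  have "R (x + (-1) *\<^sub>R y) = R x + R ((-1) *\<^sub>R y)"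
    using assms(1,3) subspace_scale[OF assms(2,4)] unfolding linear_between_def by metis
  also have "R ((-1) *\<^sub>R y) = (-1) *\<^sub>R R y"
    using assms(1,4) unfolding linear_between_def by blast
  finally show ?thesis by simp
qed

lemma (in analytic_problem) data_map_diff:
  "data_map \<Lambda> (x - y) = data_map \<Lambda> x - data_map \<Lambda> y"
  by (auto simp: data_map_def fun_eq_iff linear_diff functionals_linear)

text \<open>By density the norm of \<open>V\<close> is the supremum of all the discrete norms. That supremum is
  taken in \<open>[0, \<infinity>]\<close>, so nonnegativity of \<open>normV\<close> is what allows returning to the reals.\<close>

lemma (in MRD_discretization) restriction_norm_le:
  assumes "normed_subspace V normV" "(R, W, n) \<in> \<A>" "v \<in> V"
  shows "n (R v) \<le> normV v"
proof -
  have "ennreal (n (R v)) \<le> ennreal (normV v)"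
    unfolding density[OF assms(3)]
    using SUP_upper[OF assms(2), of "\<lambda>(R, W, n). ennreal (n (R v))"] by simp
  then show ?thesis
    using normed_subspace.nonneg[OF assms(1,3)] by simp
qed

theorem theorem8p2:
  fixes \<Lambda> :: "('u::real_normed_vector \<Rightarrow> real) set"
    and V :: "'u data set"
    and normV :: "'u data \<Rightarrow> real"
    and \<A> :: "('u data, 'w::real_vector) restriction set"
    and refines :: "('u data, 'w) restriction \<Rightarrow> ('u data, 'w) restriction \<Rightarrow> bool"
    and U\<^sub>M :: "'u set"
    and R :: "'u data \<Rightarrow> 'w" and W :: "'w set" and normW :: "'w \<Rightarrow> real"
    and v :: "'u data" and C :: real
    and uM uM' u :: 'u
  assumes "analytic_problem \<Lambda> V normV"
    and "MRD_discretization V normV \<A> refines"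
    and "subspace U\<^sub>M" and "finite_dim U\<^sub>M"
    and "(R, W, normW) \<in> \<A>"
    and "\<And>w. w \<in> U\<^sub>M \<Longrightarrow> data_seminorm \<Lambda> normV w \<le> 2 * normW (R (data_map \<Lambda> w))"
    and "v \<in> V"
    and "C \<ge> 1"
    and "uM \<in> U\<^sub>M"
    and "uM' \<in> U\<^sub>M"
    and "normW (R v - R (data_map \<Lambda> uM')) \<le> C * normW (R v - R (data_map \<Lambda> uM))"
  shows "data_seminorm \<Lambda> normV (uM' - u)
    \<le> (2 * C + 3) * data_seminorm \<Lambda> normV (uM - u) + (2 * C + 2) * normV (v - data_map \<Lambda> u)"
proof -
  interpret P: analytic_problem \<Lambda> V normV by fact
  interpret M: MRD_discretization V normV \<A> refines by fact
  interpret V: normed_subspace V normV by (rule P.normed_data_space)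
  interpret W: normed_subspace W normW by (rule M.restriction_normed) fact
  let ?D = "data_map \<Lambda>"
  note lin = M.restriction_linear[OF assms(5)]
  note D_in = P.data_map_in
  have R_in: "R x \<in> W" if "x \<in> V" for x
    using lin that unfolding linear_between_def by blast
  have R_diff: "R (x - y) = R x - R y" if "x \<in> V" "y \<in> V" for x y
    by (rule linear_between_diff[OF lin V.subspace that])

  have "normV (?D uM' - ?D uM) \<le> 2 * normW (R (?D uM') - R (?D uM))"
    using assms(6)[OF subspace_diff[OF assms(3,10,9)]]
    by (simp add: data_seminorm_def P.data_map_diff R_diff D_in)
  also have "\<dots> \<le> 2 * (normW (R v - R (?D uM')) + normW (R v - R (?D uM)))"
    using W.norm_diff_triangle[of "R (?D uM')" "R v" "R (?D uM)"]
      W.norm_diff_commute[of "R (?D uM')" "R v"]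
    by (simp add: R_in D_in assms(7))
  also have "\<dots> \<le> (2 * C + 2) * normW (R (v - ?D uM))"
    using assms(11) by (simp add: R_diff D_in assms(7) algebra_simps)
  also have "\<dots> \<le> (2 * C + 2) * normV (v - ?D uM)"
    using assms(8) subspace_diff[OF V.subspace assms(7) D_in]
    by (intro mult_left_mono M.restriction_norm_le[OF P.normed_data_space assms(5)]) auto
  also have "\<dots> \<le> (2 * C + 2) * (normV (v - ?D u) + normV (?D uM - ?D u))"
    using V.norm_diff_triangle[of v "?D u" "?D uM"]
      V.norm_diff_commute[of "?D u" "?D uM"] D_in assms(7,8)
    by (intro mult_left_mono) auto
  finally have "normV (?D uM' - ?D uM)
      \<le> (2 * C + 2) * (normV (v - ?D u) + normV (?D uM - ?D u))" .
  then show ?thesis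
    using V.norm_diff_triangle[of "?D uM'" "?D uM" "?D u"] D_in
    by (simp add: data_seminorm_def P.data_map_diff algebra_simps)
qed

end
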